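(* Let $M\subseteq\mathbb{R}^n$ be measurable. Let $\mathcal{A},\mathcal{B}\subset \mathrm{GL}(n,\mathbb{R})$ be two non-empty sets such that the product $\mathcal{A}\mathcal{B}$ is direct, and let $\mathcal{D}=\mathcal{A}\mathcal{B}=\{ab\mid a\in\mathcal{A},\ b\in\mathcal{B}\}$. Then there exists a $\mathcal{D}$-tile for $M$ if and only if there exist a measurable set $N\subseteq\mathbb{R}^n$ such that $\{aN\mid a\in\mathcal{A}\}$ is a measurable tiling of $M$, and a $\mathcal{B}$-tile for $N$.
   Context: Measurability and measure $|\cdot|$ refer to Lebesgue measure on $\mathbb{R}^n$. The product $\mathcal{A}\mathcal{B}$ is direct if $a_1b_1=a_2b_2$ with $a_1,a_2\in\mathcal{A}$, $b_1,b_2\in\mathcal{B}$ implies $a_1=a_2$ and $b_1=b_2$. A measurable tiling of a measurable set $M$ is a countable indexed collection $\{\Omega_j\}$ of measurable subsets of $M$ (inclusion up to a set of measure zero) such that $|\Omega_i\cap\Omega_j|=0$ for $i\neq j$ and $|M\setminus\bigcup_j\Omega_j|=0$. For $\mathcal{D}\subseteq\mathrm{GL}(n,\mathbb{R})$, the collection $\{d\Omega\mid d\in\mathcal{D}\}$ is regarded as indexed by $d\in\mathcal{D}$ (so $|d_1\Omega\cap d_2\Omega|=0$ is required whenever $d_1\ne d_2$). A (multiplicative) $\mathcal{D}$-tile for $M$ is a measurable set $\Omega\subseteq\mathbb{R}^n$ with $|\Omega|>0$ such that $\{d\Omega\mid d\in\mathcal{D}\}$ is a measurable tiling of $M$. It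 is not assumed that $\Omega\subseteq M$ or that $N\subseteq M$. *)

theory Defs
  imports "HOL-Analysis.Analysis"
begin

definition general_linear :: "(real^'n^'n) set" where
  "general_linear = {A. invertible A}"

definition matrix_set_mult :: "(real^'n^'n) set \<Rightarrow> (real^'n^'n) set \<Rightarrow> (real^'n^'n) set" where
  "matrix_set_mult A B = {a ** b | a b. a \<in> A \<and> b \<in> B}"

definition direct_product :: "(real^'n^'n) set \<Rightarrow> (real^'n^'n) set \<Rightarrow> bool" where
  "direct_product A B \<longleftrightarrow>
    (\<forall>a1\<in>A. \<forall>a2\<in>A. \<forall>b1\<in>B. \<forall>b2\<in>B. a1 ** b1 = a2 ** b2 \<longrightarrow> a1 = a2 \<and> b1 = b2)"

text \<open>
  A tiling is an indexed family: distinct indices must give almost disjoint sets even if the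
  sets coincide. As in the library, countable sets may be finite. Inclusion of a tile in \<open>M\<close>
  is only up to a Lebesgue null set.
\<close>

definition measurable_tiling :: "'i set \<Rightarrow> ('i \<Rightarrow> (real^'n) set) \<Rightarrow> (real^'n) set \<Rightarrow> bool" where
  "measurable_tiling I \<Omega> M \<longleftrightarrow>
    M \<in> sets lebesgue \<and>
    countable I \<and>
    (\<forall>i\<in>I. \<Omega> i \<in> sets lebesgue \<and> \<Omega> i - M \<in> null_sets lebesgue) \<and>
    (\<forall>i\<in>I. \<forall>j\<in>I. i \<noteq> j \<longrightarrow> \<Omega> i \<inter> \<Omega> j \<in> null_sets lebesgue) \<and>
    M - (\<Union>i\<in>I. \<Omega> i) \<in> null_sets lebesgue"

definition matrix_image :: "real^'n^'n \<Rightarrow> (real^'n) set \<Rightarrow> (real^'n) set" where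
  "matrix_image d S = (\<lambda>x. d *v x) ` S"

definition is_tile :: "(real^'n^'n) set \<Rightarrow> (real^'n) set \<Rightarrow> (real^'n) set \<Rightarrow> bool" where
  "is_tile D M \<Omega> \<longleftrightarrow>
    \<Omega> \<in> sets lebesgue \<and> emeasure lebesgue \<Omega> > 0 \<and>
    measurable_tiling D (\<lambda>d. matrix_image d \<Omega>) M"

end

theory Submission imports Defs begin

text \<open>
  From a \<open>D\<close>-tile \<open>\<Omega>\<close> one takes \<open>N = (\<Union>b\<in>B. b \<Omega>)\<close>; conversely a \<open>B\<close>-tile for \<open>N\<close> is already
  a \<open>D\<close>-tile for \<open>M\<close>. Invertible matrices preserve and reflect null sets, and all the
  exceptional sets are covered by countably many images of null ones.
\<close>

lemma matrix_image_mult: "matrix_image (a ** b) S = matrix_image a (matrix_image b S)"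
  by (simp add: matrix_image_def image_image matrix_vector_mul_assoc)

lemma matrix_image_UN: "matrix_image a (\<Union>i\<in>I. S i) = (\<Union>i\<in>I. matrix_image a (S i))"
  by (auto simp: matrix_image_def)

lemma matrix_image_diff_subset: "matrix_image a S - matrix_image a T \<subseteq> matrix_image a (S - T)"
  by (auto simp: matrix_image_def)

text \<open>An invertible matrix acts injectively, which is what lets its image commute with
  intersections.\<close>

lemma matrix_image_Int:
  assumes "invertible a"
  shows "matrix_image a (S \<inter> T) = matrix_image a S \<inter> matrix_image a T"
  unfolding matrix_image_def by (rule image_Int) (use assms in \<open>rule inj_matrix_vector_mult\<close>)

text \<open>A linear map is differentiable, and a differentiable map of \<real>^n to itself sends
  Lebesgue sets to Lebesgue sets.\<close>

lemma matrix_image_lebesgue: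
  assumes "S \<in> sets lebesgue"
  shows "matrix_image a S \<in> sets lebesgue"
  unfolding matrix_image_def
  by (rule differentiable_image_in_sets_lebesgue[OF assms])
     (auto intro: linear_imp_differentiable_on)

lemma matrix_image_null_sets:
  assumes "S \<in> null_sets lebesgue"
  shows "matrix_image a S \<in> null_sets lebesgue"
  using assms unfolding matrix_image_def negligible_iff_null_sets[symmetric]
  by (intro negligible_differentiable_image_negligible) (auto intro: linear_imp_differentiable_on)

text \<open>A left inverse \<open>a'\<close> recovers \<open>S\<close> as the linear image of a null
  set.\<close>

lemma matrix_image_null_setsD:
  assumes "invertible a" "matrix_image a S \<in> null_sets lebesgue"
  shows "S \<in> null_sets lebesgue"
proof -
  obtain a' where "a' ** a = mat 1"
    using assms(1) unfolding invertible_def by blast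
  then have "matrix_image a' (matrix_image a S) = S"
    by (simp add: matrix_image_mult[symmetric]) (simp add: matrix_image_def)
  then show ?thesis
    using matrix_image_null_sets[OF assms(2), of a'] by simp
qed

text \<open>This is completeness of Lebesgue measure: an exceptional set only has to be covered by a
  null set, without a separate check of measurability.\<close>

lemma null_sets_lebesgue_subset:
  "T \<in> null_sets lebesgue \<Longrightarrow> S \<subseteq> T \<Longrightarrow> S \<in> null_sets lebesgue"
  using negligible_subset by (auto simp: negligible_iff_null_sets)

text \<open>By directness, multiplication by a fixed element of one factor embeds the other factor
  into the product; non-emptiness supplies that element.\<close>

lemma countable_factors:
  assumes "direct_product A B" "A \<noteq> {}" "B \<noteq> {}" "countable (matrix_set_mult A B)"
  shows "countable A" "countable B"
proof -
  obtain a b where "a \<in> A" "b \<in> B"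
    using assms by blast
  have "inj_on (\<lambda>x. x ** b) A" "inj_on (\<lambda>y. a ** y) B"
    using assms(1) \<open>a \<in> A\<close> \<open>b \<in> B\<close> by (auto simp: inj_on_def direct_product_def)
  moreover have "(\<lambda>x. x ** b) ` A \<subseteq> matrix_set_mult A B" "(\<lambda>y. a ** y) ` B \<subseteq> matrix_set_mult A B"
    using \<open>a \<in> A\<close> \<open>b \<in> B\<close> by (auto simp: matrix_set_mult_def)
  ultimately show "countable A" "countable B"
    using assms(4) by (meson countable_image_inj_on countable_subset)+
qed

lemma product_tile_imp_factor_tiles:
  assumes "A \<subseteq> general_linear" "A \<noteq> {}" "B \<noteq> {}" "direct_product A B"
    and tile: "is_tile (matrix_set_mult A B) M \<Omega>"
  defines "N \<equiv> \<Union>b\<in>B. matrix_image b \<Omega>"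
  shows "measurable_tiling A (\<lambda>a. matrix_image a N) M" "is_tile B N \<Omega>"
proof -
  have \<Omega>: "\<Omega> \<in> sets lebesgue" "emeasure lebesgue \<Omega> > 0"
    and M: "M \<in> sets lebesgue" and "countable (matrix_set_mult A B)"
    and incl: "\<And>a b. a \<in> A \<Longrightarrow> b \<in> B \<Longrightarrow> matrix_image (a ** b) \<Omega> - M \<in> null_sets lebesgue"
    and disj: "\<And>a b c d. a \<in> A \<Longrightarrow> b \<in> B \<Longrightarrow> c \<in> A \<Longrightarrow> d \<in> B \<Longrightarrow> a ** b \<noteq> c ** d \<Longrightarrow>
        matrix_image (a ** b) \<Omega> \<inter> matrix_image (c ** d) \<Omega> \<in> null_sets lebesgue"
    and cover: "M - (\<Union>d\<in>matrix_set_mult A B. matrix_image d \<Omega>) \<in> null_sets lebesgue"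
    using tile unfolding is_tile_def measurable_tiling_def matrix_set_mult_def by blast+
  have A: "countable A" and B: "countable B"
    using countable_factors[OF assms(4,2,3) \<open>countable (matrix_set_mult A B)\<close>] by auto
  have N: "N \<in> sets lebesgue"
    unfolding N_def using B \<Omega> by (intro sets.countable_UN'' matrix_image_lebesgue) auto
  \<comment> \<open>Each copy of \<open>N\<close> is thus a countable union of tiles of the given
    tiling of \<open>M\<close>, so its properties reduce to theirs.\<close>
  have aN: "matrix_image a N = (\<Union>b\<in>B. matrix_image (a ** b) \<Omega>)" for a
    by (simp add: N_def matrix_image_UN matrix_image_mult)
  show "measurable_tiling A (\<lambda>a. matrix_image a N) M"
    unfolding measurable_tiling_def
  proof (intro conjI ballI impI)
    fix a assume a: "a \<in> A"
    have "(\<Union>b\<in>B. matrix_image (a ** b) \<Omega> - M) \<in> null_sets lebesgue"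
      using B incl a by (intro null_sets_UN') auto
    then show "matrix_image a N - M \<in> null_sets lebesgue"
      by (rule null_sets_lebesgue_subset) (auto simp: aN)
    fix c assume c: "c \<in> A" "a \<noteq> c"
    \<comment> \<open>Directness enters here: different left factors never give the same product, so
      every tile in \<open>a N\<close> is almost disjoint from every tile in
      \<open>c N\<close>.\<close>
    have "a ** b \<noteq> c ** d" if "b \<in> B" "d \<in> B" for b d
      using assms(4) a c that unfolding direct_product_def by blast
    then have "(\<Union>b\<in>B. \<Union>d\<in>B. matrix_image (a ** b) \<Omega> \<inter> matrix_image (c ** d) \<Omega>)
        \<in> null_sets lebesgue"
      using B disj a c by (intro null_sets_UN') auto
    then show "matrix_image a N \<inter> matrix_image c N \<in> null_sets lebesgue"
      by (rule null_sets_lebesgue_subset) (auto simp: aN)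
  next
    show "M - (\<Union>a\<in>A. matrix_image a N) \<in> null_sets lebesgue"
      using cover by (rule null_sets_lebesgue_subset) (auto simp: aN matrix_set_mult_def)
  qed (use M A N in \<open>auto intro: matrix_image_lebesgue\<close>)
  \<comment> \<open>One fixed \<open>a\<close> suffices to compare tiles of \<open>N\<close>: it
    carries them to tiles of \<open>M\<close>, whose null intersection is then pulled back through
    \<open>a\<close>.\<close>
  obtain a where a: "a \<in> A" "invertible a"
    using assms(1,2) by (auto simp: general_linear_def)
  have "matrix_image b \<Omega> \<inter> matrix_image d \<Omega> \<in> null_sets lebesgue"
    if "b \<in> B" "d \<in> B" "b \<noteq> d" for b d
  proof (rule matrix_image_null_setsD[OF a(2)])
    have "a ** b \<noteq> a ** d"
      using assms(4) a that unfolding direct_product_def by blast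
    then show "matrix_image a (matrix_image b \<Omega> \<inter> matrix_image d \<Omega>) \<in> null_sets lebesgue"
      using disj a that by (simp add: matrix_image_Int matrix_image_mult[symmetric])
  qed
  moreover have "matrix_image b \<Omega> - N \<in> null_sets lebesgue" if "b \<in> B" for b
    by (rule null_sets_lebesgue_subset[OF null_sets.empty_sets]) (use that in \<open>auto simp: N_def\<close>)
  \<comment> \<open>Folding the union back into \<open>N\<close> turns the covering condition into
    \<open>N - N\<close>, which is empty.\<close>
  ultimately show "is_tile B N \<Omega>"
    using \<Omega> N B by (auto simp: is_tile_def measurable_tiling_def matrix_image_lebesgue
        simp flip: N_def)
qed

text \<open>A tiling of \<open>N\<close> is carried by each \<open>a\<close> to a tiling of
  \<open>a N\<close>, and these together refine the tiling of \<open>M\<close> by the copies of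
  \<open>N\<close>.\<close>

lemma factor_tiles_imp_product_tile:
  assumes "A \<subseteq> general_linear"
    and tiling: "measurable_tiling A (\<lambda>a. matrix_image a N) M"
    and tile: "is_tile B N \<Omega>"
  shows "is_tile (matrix_set_mult A B) M \<Omega>"
proof -
  have M: "M \<in> sets lebesgue" and A: "countable A"
    and inclM: "\<And>a. a \<in> A \<Longrightarrow> matrix_image a N - M \<in> null_sets lebesgue"
    and disjM: "\<And>a c. a \<in> A \<Longrightarrow> c \<in> A \<Longrightarrow> a \<noteq> c \<Longrightarrow>
        matrix_image a N \<inter> matrix_image c N \<in> null_sets lebesgue"
    and coverM: "M - (\<Union>a\<in>A. matrix_image a N) \<in> null_sets lebesgue"
    using tiling unfolding measurable_tiling_def by blast+
  have \<Omega>: "\<Omega> \<in> sets lebesgue" "emeasure lebesgue \<Omega> > 0" and B: "countable B"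
    and inclN: "\<And>b. b \<in> B \<Longrightarrow> matrix_image b \<Omega> - N \<in> null_sets lebesgue"
    and disjN: "\<And>b d. b \<in> B \<Longrightarrow> d \<in> B \<Longrightarrow> b \<noteq> d \<Longrightarrow>
        matrix_image b \<Omega> \<inter> matrix_image d \<Omega> \<in> null_sets lebesgue"
    and coverN: "N - (\<Union>b\<in>B. matrix_image b \<Omega>) \<in> null_sets lebesgue"
    using tile unfolding is_tile_def measurable_tiling_def by blast+
  have incl: "matrix_image (a ** b) \<Omega> - matrix_image a N \<in> null_sets lebesgue"
    if "b \<in> B" for a b
    unfolding matrix_image_mult
    by (rule null_sets_lebesgue_subset[OF matrix_image_null_sets[OF inclN[OF that]]
          matrix_image_diff_subset])
  have "measurable_tiling (matrix_set_mult A B) (\<lambda>d. matrix_image d \<Omega>) M"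
    unfolding measurable_tiling_def
  proof (intro conjI ballI impI)
    have "matrix_set_mult A B = (\<lambda>(a, b). a ** b) ` (A \<times> B)"
      by (auto simp: matrix_set_mult_def)
    then show "countable (matrix_set_mult A B)"
      using A B by simp
  next
    fix p assume "p \<in> matrix_set_mult A B"
    then obtain a b where p: "p = a ** b" "a \<in> A" "b \<in> B"
      by (auto simp: matrix_set_mult_def)
    \<comment> \<open>A point of \<open>p \<Omega>\<close> outside \<open>M\<close> lies either
      outside \<open>a N\<close> or in \<open>a N\<close> but outside \<open>M\<close>.\<close>
    show "matrix_image p \<Omega> - M \<in> null_sets lebesgue"
      by (rule null_sets_lebesgue_subset[OF null_sets.Un[OF incl[of b a] inclM[of a]]])
         (auto simp: p)
    fix q assume "q \<in> matrix_set_mult A B" "p \<noteq> q"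
    then obtain c d where q: "q = c ** d" "c \<in> A" "d \<in> B"
      by (auto simp: matrix_set_mult_def)
    show "matrix_image p \<Omega> \<inter> matrix_image q \<Omega> \<in> null_sets lebesgue"
    \<comment> \<open>With equal left factors, \<open>p \<noteq> q\<close> forces
      \<open>b \<noteq> d\<close>, and the overlap is the image under \<open>a\<close> of an overlap
      inside the tiling of \<open>N\<close>.\<close>
    proof (cases "a = c")
      case True
      then have "matrix_image a (matrix_image b \<Omega> \<inter> matrix_image d \<Omega>) \<in> null_sets lebesgue"
        using p q \<open>p \<noteq> q\<close> by (intro matrix_image_null_sets disjN) auto
      moreover have "invertible a"
        using assms(1) p by (auto simp: general_linear_def)
      ultimately show ?thesis
        using True p q by (simp add: matrix_image_Int matrix_image_mult)
    next
      case False
      \<comment> \<open>The two tiles lie almost inside \<open>a N\<close> and \<open>c N\<close>,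
        so their overlap is covered by two exceptional sets and the null set
        \<open>a N \<inter> c N\<close>.\<close>
      show ?thesis
        by (rule null_sets_lebesgue_subset
              [OF null_sets.Un[OF null_sets.Un[OF incl[of b a] incl[of d c]] disjM[of a c]]])
           (use False p q in auto)
    qed
  next
    \<comment> \<open>What the product tiles miss of \<open>a N\<close> lies in the image under
      \<open>a\<close> of what the \<open>B\<close>-tiles miss of \<open>N\<close>; countably many
      such images remain null.\<close>
    have "(\<Union>a\<in>A. matrix_image a (N - (\<Union>b\<in>B. matrix_image b \<Omega>))) \<in> null_sets lebesgue"
      using A coverN by (intro null_sets_UN' matrix_image_null_sets) auto
    then show "M - (\<Union>d\<in>matrix_set_mult A B. matrix_image d \<Omega>) \<in> null_sets lebesgue"
    proof (rule null_sets_lebesgue_subset[OF null_sets.Un[OF coverM]])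
      have "matrix_image a N \<subseteq> matrix_image a (N - (\<Union>b\<in>B. matrix_image b \<Omega>))
          \<union> (\<Union>d\<in>matrix_set_mult A B. matrix_image d \<Omega>)" if "a \<in> A" for a
        using matrix_image_diff_subset[of a N "\<Union>b\<in>B. matrix_image b \<Omega>"] that
        by (fastforce simp: matrix_image_UN matrix_image_mult[symmetric] matrix_set_mult_def)
      then show "M - (\<Union>d\<in>matrix_set_mult A B. matrix_image d \<Omega>)
          \<subseteq> (M - (\<Union>a\<in>A. matrix_image a N))
            \<union> (\<Union>a\<in>A. matrix_image a (N - (\<Union>b\<in>B. matrix_image b \<Omega>)))"
        by blast
    qed
  qed (use M \<Omega> in \<open>auto intro: matrix_image_lebesgue\<close>)
  then show ?thesis
    using \<Omega> by (simp add: is_tile_def)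
qed

theorem lemma2p1:
  fixes M :: "(real^'n) set" and A B D :: "(real^'n^'n) set"
  assumes "M \<in> sets lebesgue"
    and "A \<subseteq> general_linear" and "B \<subseteq> general_linear"
    and "A \<noteq> {}" and "B \<noteq> {}"
    and "direct_product A B"
    and "D = matrix_set_mult A B"
  shows "(\<exists>\<Omega>. is_tile D M \<Omega>) \<longleftrightarrow>
    (\<exists>N. N \<in> sets lebesgue \<and> measurable_tiling A (\<lambda>a. matrix_image a N) M \<and>
         (\<exists>\<Omega>. is_tile B N \<Omega>))"
proof
  assume "\<exists>\<Omega>. is_tile D M \<Omega>"
  then obtain \<Omega> where "is_tile (matrix_set_mult A B) M \<Omega>"
    using assms(7) by blast
  note tiles = product_tile_imp_factor_tiles[OF assms(2,4,5,6) this]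
  \<comment> \<open>This union is the witness for \<open>N\<close>; it is measurable because being
    tiled includes measurability of the tiled set.\<close>
  moreover have "(\<Union>b\<in>B. matrix_image b \<Omega>) \<in> sets lebesgue"
    using tiles(2) by (simp add: is_tile_def measurable_tiling_def)
  ultimately show "\<exists>N. N \<in> sets lebesgue \<and> measurable_tiling A (\<lambda>a. matrix_image a N) M \<and>
      (\<exists>\<Omega>. is_tile B N \<Omega>)"
    by blast
next
  assume "\<exists>N. N \<in> sets lebesgue \<and> measurable_tiling A (\<lambda>a. matrix_image a N) M \<and>
      (\<exists>\<Omega>. is_tile B N \<Omega>)"
  then show "\<exists>\<Omega>. is_tile D M \<Omega>"
    using factor_tiles_imp_product_tile[OF assms(2)] assms(7) by blast
qed

end
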